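(* For any $n,d\in\mathbb{N}$ there exists a finite simple connected graph $G$ with $|V(G)|\ge n$ and $\operatorname{diam}(G)\ge d$ such that $G$ is DMR and CDDR, but not DP.
   Context: All graphs are finite, simple and connected. $\Gamma_i(u)$ is the set of vertices at distance exactly $i$ from $u$; $A_i(G)$ is the $0/1$ matrix with $(u,v)$-entry $1$ iff $d(u,v)=i$. $G$ is CDDR (commutative distance degree-regular) if $|\Gamma_i(u)\cap\Gamma_j(v)|=|\Gamma_i(v)\cap\Gamma_j(u)|$ for all vertices $u,v$ and all $1\le i,j\le\operatorname{diam}(G)$. $G$ is DMR (distance mean-regular) if for all $0\le h,i,j\le\operatorname{diam}(G)$ the average $\frac{1}{|\Gamma_h(u)|}\sum_{v\in\Gamma_h(u)}|\Gamma_i(u)\cap\Gamma_j(v)|$ depends only on $h,i,j$ and not on the vertex $u$. $G$ is DP (distance-polynomial) if for every $1\le i\le\operatorname{diam}(G)$ the matrix $A_i(G)$ is a polynomial in the adjacency matrix $A_1(G)$. *)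

theory Defs
  imports
    "Graph_Theory.Graph_Theory"
    "Jordan_Normal_Form.Matrix"
    "HOL-Computational_Algebra.Polynomial"
begin

text \<open>
  A finite simple graph is a \<open>pair_graph\<close>: finitely many vertices, and a symmetric irreflexive
  relation as set of arcs. The metric notions below are meant for connected graphs only; for
  unreachable \<open>v\<close> the value of \<open>gdist G u v\<close> is unspecified.
\<close>

definition gdist :: "('a, 'b) pre_digraph \<Rightarrow> 'a \<Rightarrow> 'a \<Rightarrow> nat" where
  "gdist G u v = (LEAST k. \<exists>p. pre_digraph.awalk G u p v \<and> length p = k)"

lemma (in wf_digraph) gdist_eq_unit_weight_distance:
  assumes "u \<rightarrow>\<^sup>* v"
  shows "\<mu> (\<lambda>_. 1) u v = ereal (real (gdist G u v))"
proof -
  have cost: "awalk_cost (\<lambda>_. 1) p = real (length p)" for p :: "'b list"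
    by (induction p) auto
  from assms obtain q where "awalk u q v"
    by (auto simp: reachable_awalk)
  then have "\<exists>k p. awalk u p v \<and> length p = k"
    by blast
  then have ex: "\<exists>p. awalk u p v \<and> length p = gdist G u v"
    unfolding gdist_def by (rule LeastI_ex)
  have least: "gdist G u v \<le> length p" if "awalk u p v" for p
    unfolding gdist_def by (rule Least_le) (use that in blast)
  show ?thesis
    unfolding \<mu>_def cost
  proof (rule antisym)
    show "(INF p\<in>{p. awalk u p v}. ereal (real (length p))) \<le> ereal (real (gdist G u v))"
      using ex by (auto intro!: INF_lower2)
    show "ereal (real (gdist G u v)) \<le> (INF p\<in>{p. awalk u p v}. ereal (real (length p)))"
      using least by (auto intro!: INF_greatest)
  qed
qed

definition diam :: "('a, 'b) pre_digraph \<Rightarrow> nat" where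
  "diam G = Max {gdist G u v | u v. u \<in> verts G \<and> v \<in> verts G}"

definition sphere_at :: "('a, 'b) pre_digraph \<Rightarrow> nat \<Rightarrow> 'a \<Rightarrow> 'a set" where
  "sphere_at G i u = {v \<in> verts G. gdist G u v = i}"

definition CDDR :: "('a, 'b) pre_digraph \<Rightarrow> bool" where
  "CDDR G \<longleftrightarrow>
    (\<forall>u\<in>verts G. \<forall>v\<in>verts G. \<forall>i\<in>{1..diam G}. \<forall>j\<in>{1..diam G}.
      card (sphere_at G i u \<inter> sphere_at G j v) = card (sphere_at G i v \<inter> sphere_at G j u))"

text \<open>
  If \<open>sphere_at G h u\<close> is empty, the quotient in the next definition is \<open>0\<close> by convention.
  This does not admit graphs in which an average is undefined: for \<open>i = h\<close> and \<open>j = 0\<close> the average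
  is \<open>1\<close> at every vertex \<open>u\<close> with a nonempty sphere of radius \<open>h\<close>, and such a vertex exists
  whenever \<open>h \<le> diam G\<close>, so the condition forces all these spheres to be nonempty.
\<close>

definition DMR :: "('a, 'b) pre_digraph \<Rightarrow> bool" where
  "DMR G \<longleftrightarrow>
    (\<forall>h\<in>{0..diam G}. \<forall>i\<in>{0..diam G}. \<forall>j\<in>{0..diam G}. \<exists>c::real. \<forall>u\<in>verts G.
      (\<Sum>v\<in>sphere_at G h u. real (card (sphere_at G i u \<inter> sphere_at G j v)))
        / real (card (sphere_at G h u)) = c)"

text \<open>
  Rows and columns are indexed by the vertices in increasing order. Another enumeration of the
  vertices would conjugate all distance matrices by the same permutation matrix, which does not
  affect the property \<open>DP\<close>.
\<close>

definition dist_mat :: "('a::linorder, 'b) pre_digraph \<Rightarrow> nat \<Rightarrow> real mat" where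
  "dist_mat G i =
    (let vs = sorted_list_of_set (verts G) in
      mat (length vs) (length vs) (\<lambda>(r, c). if gdist G (vs ! r) (vs ! c) = i then 1 else 0))"

definition poly_at_mat :: "'a::comm_ring_1 poly \<Rightarrow> 'a mat \<Rightarrow> 'a mat" where
  "poly_at_mat p A =
    mat (dim_row A) (dim_row A)
      (\<lambda>(r, c). \<Sum>k\<le>Polynomial.degree p. Polynomial.coeff p k * (A ^\<^sub>m k) $$ (r, c))"

definition DP :: "('a::linorder, 'b) pre_digraph \<Rightarrow> bool" where
  "DP G \<longleftrightarrow>
    (\<forall>i\<in>{1..diam G}. \<exists>p::real poly. dist_mat G i = poly_at_mat p (dist_mat G 1))"

end

theory Submission
  imports Defs
begin

text \<open>
  Take a cycle \<open>C\<^sub>n\<close> with \<open>n \<ge> 6\<close> a multiple of 3 and replace every vertex by an edge, joining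
  completely the edges that sit over neighbouring vertices of the cycle. The diameter grows like
  \<open>n div 2\<close>, so both bounds of the theorem are met for large \<open>n\<close>.

  The graph is made of the residues modulo \<open>2 * n\<close>, with adjacency and distance depending only on
  the difference \<open>x - y\<close> up to sign. Hence for all \<open>u\<close>, \<open>v\<close> the reflection
  \<open>x \<mapsto> u + v - x\<close> is an isometry that exchanges \<open>u\<close> and \<open>v\<close>. Such a symmetry makes the defining
  identity of CDDR trivial, and as it moves \<open>u\<close> to \<open>v\<close> it also makes all averages in DMR
  independent of the base vertex (\<open>generously_transitive_imp_CDDR\<close>,
  \<open>generously_transitive_imp_DMR\<close>).

  If a distance matrix \<open>A\<^sub>i\<close> is a polynomial \<open>p(A\<^sub>1)\<close>, it acts on the whole eigenspace of \<open>A\<^sub>1\<close> for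
  an eigenvalue \<open>a\<close> as the single scalar \<open>p(a)\<close> (\<open>DP_sphere_eigenfunction\<close>). This fails here for
  \<open>i = 2\<close> and \<open>a = - 1\<close>. One eigenfunction is the difference of the indicators of two twins, that is,
  of the ends of one of the inserted edges: twins have the same closed neighbourhood, and \<open>A\<^sub>2\<close>
  annihilates the function, since twins have equal distances to all other vertices.
  Another one is the function with values 2, -1, -1 repeated along the cycle, which sums to 0 over
  every closed neighbourhood, but has sum -4 over the sphere of radius 2 about a vertex of value 2
  (\<open>not_DP_doubled_cycle\<close>).
\<close>

section \<open>Distances and symmetries\<close>

text \<open>
  A candidate for the distance from \<open>u\<close> is correct if it grows by at most 1 along each arc, which
  bounds the length of every walk from below, and if every other vertex has a predecessor of
  smaller value, from which a walk that is short enough is built backwards.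
\<close>

lemma (in wf_digraph) gdist_eqI:
  fixes \<delta> :: "'a \<Rightarrow> nat"
  assumes u: "u \<in> verts G" and zero: "\<delta> u = 0"
    and lipschitz: "\<And>e. e \<in> arcs G \<Longrightarrow> \<delta> (head G e) \<le> Suc (\<delta> (tail G e))"
    and descent: "\<And>v. v \<in> verts G \<Longrightarrow> v \<noteq> u \<Longrightarrow>
      \<exists>e\<in>arcs G. head G e = v \<and> \<delta> (tail G e) < \<delta> v"
    and v: "v \<in> verts G"
  shows "u \<rightarrow>\<^sup>* v" and "gdist G u v = \<delta> v"
proof -
  have lower: "\<delta> w \<le> \<delta> x + length p" if "awalk x p w" for x p w
    using that
  proof (induction p arbitrary: x)
    case Nil
    then show ?case by (simp add: awalk_Nil_iff)
  next
    case (Cons e p)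
    then have "e \<in> arcs G" "x = tail G e" "\<delta> w \<le> \<delta> (head G e) + length p"
      by (auto simp: awalk_Cons_iff)
    with lipschitz[of e] show ?case by simp
  qed
  have upper: "\<exists>p. awalk u p v \<and> length p \<le> \<delta> v"
    using v
  proof (induction "\<delta> v" arbitrary: v rule: less_induct)
    case less
    show ?case
    proof (cases "v = u")
      case True
      with u have "awalk u [] v" by (simp add: awalk_Nil_iff)
      then show ?thesis by force
    next
      case False
      with descent less.prems obtain e
        where e: "e \<in> arcs G" "head G e = v" "\<delta> (tail G e) < \<delta> v" by blast
      then obtain p where p: "awalk u p (tail G e)" "length p \<le> \<delta> (tail G e)"
        using less.hyps by (meson tail_in_verts)
      have "awalk (tail G e) [e] v"
        using arc_implies_awalk e by metis
      with p(1) have "awalk u (p @ [e]) v"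
        by (rule awalk_appendI)
      moreover have "length (p @ [e]) \<le> \<delta> v"
        using p(2) e(3) by simp
      ultimately show ?thesis by blast
    qed
  qed
  then obtain p where p: "awalk u p v" "length p \<le> \<delta> v" by blast
  then show "u \<rightarrow>\<^sup>* v" by (simp add: reachable_awalkI)
  show "gdist G u v = \<delta> v"
    unfolding gdist_def
  proof (rule Least_equality)
    show "\<exists>q. awalk u q v \<and> length q = \<delta> v"
      using p lower[OF p(1)] zero by auto
    show "\<delta> v \<le> k" if "\<exists>q. awalk u q v \<and> length q = k" for k
      using that lower zero by force
  qed
qed

definition gdist_isometry :: "('a, 'b) pre_digraph \<Rightarrow> ('a \<Rightarrow> 'a) \<Rightarrow> bool" where
  "gdist_isometry G \<phi> \<longleftrightarrow> bij_betw \<phi> (verts G) (verts G) \<and>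
    (\<forall>x\<in>verts G. \<forall>y\<in>verts G. gdist G (\<phi> x) (\<phi> y) = gdist G x y)"

lemma gdist_isometry_sphere:
  assumes \<phi>: "gdist_isometry G \<phi>" and u: "u \<in> verts G"
  shows "\<phi> ` sphere_at G i u = sphere_at G i (\<phi> u)"
proof -
  have "\<phi> ` verts G = verts G"
    using \<phi> by (auto simp: gdist_isometry_def bij_betw_def)
  moreover have "gdist G (\<phi> u) (\<phi> x) = gdist G u x" if "x \<in> verts G" for x
    using \<phi> u that by (auto simp: gdist_isometry_def)
  ultimately show ?thesis
    unfolding sphere_at_def by force
qed

lemma gdist_isometry_inj_on:
  assumes "gdist_isometry G \<phi>" "A \<subseteq> verts G"
  shows "inj_on \<phi> A"
proof (rule inj_on_subset)
  show "inj_on \<phi> (verts G)"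
    using assms(1) by (simp add: gdist_isometry_def bij_betw_def)
qed (rule assms(2))

lemma sphere_at_subset: "sphere_at G i u \<subseteq> verts G"
  by (auto simp: sphere_at_def)

lemma gdist_isometry_card_spheres:
  assumes \<phi>: "gdist_isometry G \<phi>" and u: "u \<in> verts G" and v: "v \<in> verts G"
  shows "card (sphere_at G i (\<phi> u) \<inter> sphere_at G j (\<phi> v)) =
    card (sphere_at G i u \<inter> sphere_at G j v)"
proof -
  have "\<phi> ` (sphere_at G i u \<inter> sphere_at G j v) =
      \<phi> ` sphere_at G i u \<inter> \<phi> ` sphere_at G j v"
    by (rule inj_on_image_Int[OF gdist_isometry_inj_on[OF \<phi> subset_refl]])
      (auto simp: sphere_at_def)
  also have "\<dots> = sphere_at G i (\<phi> u) \<inter> sphere_at G j (\<phi> v)"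
    by (simp add: gdist_isometry_sphere[OF \<phi>] u v)
  finally have "card (sphere_at G i (\<phi> u) \<inter> sphere_at G j (\<phi> v)) =
      card (\<phi> ` (sphere_at G i u \<inter> sphere_at G j v))"
    by simp
  also have "\<dots> = card (sphere_at G i u \<inter> sphere_at G j v)"
    by (intro card_image gdist_isometry_inj_on[OF \<phi>]) (auto simp: sphere_at_def)
  finally show ?thesis .
qed

text \<open>
  Usually said of permutation groups; here the group is that of all bijections of the
  vertices that preserve distances.
\<close>

definition generously_transitive :: "('a, 'b) pre_digraph \<Rightarrow> bool" where
  "generously_transitive G \<longleftrightarrow>
    (\<forall>u\<in>verts G. \<forall>v\<in>verts G. \<exists>\<phi>. gdist_isometry G \<phi> \<and> \<phi> u = v \<and> \<phi> v = u)"

lemma generously_transitive_imp_CDDR: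
  assumes "generously_transitive G"
  shows "CDDR G"
  unfolding CDDR_def
proof (intro ballI)
  fix u v i j assume uv: "u \<in> verts G" "v \<in> verts G"
  with assms obtain \<phi> where "gdist_isometry G \<phi>" "\<phi> u = v" "\<phi> v = u"
    unfolding generously_transitive_def by blast
  with gdist_isometry_card_spheres[of G \<phi> v u i j] uv
  show "card (sphere_at G i u \<inter> sphere_at G j v) = card (sphere_at G i v \<inter> sphere_at G j u)"
    by simp
qed

lemma generously_transitive_imp_DMR:
  assumes G: "generously_transitive G"
  shows "DMR G"
proof -
  define avg where "avg h i j u =
    (\<Sum>v\<in>sphere_at G h u. real (card (sphere_at G i u \<inter> sphere_at G j v)))
      / real (card (sphere_at G h u))" for h i j u
  have "avg h i j v = avg h i j u" if u: "u \<in> verts G" and v: "v \<in> verts G" for h i j u v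
  proof -
    from G u v obtain \<phi> where \<phi>: "gdist_isometry G \<phi>" and uv: "\<phi> u = v"
      by (auto simp: generously_transitive_def)
    have img: "sphere_at G h v = \<phi> ` sphere_at G h u"
      by (simp add: gdist_isometry_sphere[OF \<phi> u] uv)
    have inj: "inj_on \<phi> (sphere_at G h u)"
      by (rule gdist_isometry_inj_on[OF \<phi> sphere_at_subset])
    have "(\<Sum>x\<in>sphere_at G h v. real (card (sphere_at G i v \<inter> sphere_at G j x))) =
        (\<Sum>x\<in>sphere_at G h u. real (card (sphere_at G i u \<inter> sphere_at G j x)))"
      unfolding img sum.reindex[OF inj] o_def
    proof (rule sum.cong)
      fix x assume "x \<in> sphere_at G h u"
      then have "x \<in> verts G" by (simp add: sphere_at_def)
      from gdist_isometry_card_spheres[OF \<phi> u this]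
      show "real (card (sphere_at G i v \<inter> sphere_at G j (\<phi> x))) =
          real (card (sphere_at G i u \<inter> sphere_at G j x))"
        by (simp add: uv)
    qed simp
    moreover have "card (sphere_at G h v) = card (sphere_at G h u)"
      unfolding img by (rule card_image[OF inj])
    ultimately show ?thesis by (simp add: avg_def)
  qed
  then have "\<exists>c. \<forall>u\<in>verts G. avg h i j u = c" for h i j
    by blast
  then show ?thesis
    unfolding DMR_def avg_def by blast
qed


section \<open>Eigenfunctions of distance-polynomial graphs\<close>

text \<open>Evaluation at a matrix is defined entrywise, so the usual fact on eigenvectors is derived here.\<close>

lemma poly_at_mat_mult_vec:
  fixes A :: "'a::field mat"
  assumes A: "A \<in> carrier_mat m m" and x: "x \<in> carrier_vec m"
    and eigen: "A *\<^sub>v x = a \<cdot>\<^sub>v x"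
  shows "poly_at_mat p A *\<^sub>v x = poly p a \<cdot>\<^sub>v x"
proof -
  have pow: "(A ^\<^sub>m k) *\<^sub>v x = a ^ k \<cdot>\<^sub>v x" for k
  proof (induction k)
    case 0
    then show ?case using A x by simp
  next
    case (Suc k)
    have "(A ^\<^sub>m Suc k) *\<^sub>v x = (A ^\<^sub>m k) *\<^sub>v (A *\<^sub>v x)"
      using A x by (simp add: assoc_mult_mat_vec[OF pow_carrier_mat[OF A] A x])
    also have "\<dots> = a \<cdot>\<^sub>v ((A ^\<^sub>m k) *\<^sub>v x)"
      unfolding eigen by (rule mult_mat_vec[OF pow_carrier_mat[OF A] x])
    also have "\<dots> = a ^ Suc k \<cdot>\<^sub>v x"
      by (simp add: Suc smult_smult_assoc)
    finally show ?case .
  qed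
  have dims: "dim_row A = m" "dim_col A = m" "dim_vec x = m"
    using A x by auto
  have dimk: "dim_row (A ^\<^sub>m k) = m" "dim_col (A ^\<^sub>m k) = m" for k
    using pow_carrier_mat[OF A, of k] by auto
  show ?thesis
  proof (rule eq_vecI)
    fix r assume "r < dim_vec (poly p a \<cdot>\<^sub>v x)"
    then have r: "r < m" by (simp add: dims)
    have powr: "(\<Sum>c = 0..<m. (A ^\<^sub>m k) $$ (r, c) * x $ c) = a ^ k * x $ r" for k
    proof -
      have "(\<Sum>c = 0..<m. (A ^\<^sub>m k) $$ (r, c) * x $ c) = ((A ^\<^sub>m k) *\<^sub>v x) $ r"
        using r by (simp add: scalar_prod_def dims dimk)
      then show ?thesis using r by (simp add: pow dims)
    qed
    have "(poly_at_mat p A *\<^sub>v x) $ r =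
        (\<Sum>c = 0..<m. (\<Sum>k\<le>Polynomial.degree p. coeff p k * (A ^\<^sub>m k) $$ (r, c)) * x $ c)"
      using r by (simp add: poly_at_mat_def scalar_prod_def dims)
    also have "\<dots> = (\<Sum>k\<le>Polynomial.degree p. coeff p k * (\<Sum>c = 0..<m. (A ^\<^sub>m k) $$ (r, c) * x $ c))"
      unfolding sum_distrib_right sum_distrib_left
      by (subst sum.swap) (simp add: mult.assoc)
    also have "\<dots> = poly p a * x $ r"
      by (simp add: powr poly_altdef sum_distrib_right mult.assoc)
    finally show "(poly_at_mat p A *\<^sub>v x) $ r = (poly p a \<cdot>\<^sub>v x) $ r"
      using r by (simp add: dims)
  qed (simp add: poly_at_mat_def dims)
qed

text \<open>
  This turns statements about distance matrices into statements about sums over spheres, so that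
  the enumeration of the vertices can be forgotten.
\<close>

lemma dist_mat_mult_vec:
  fixes G :: "('a::linorder, 'b) pre_digraph" and f :: "'a \<Rightarrow> real"
  assumes fin: "finite (verts G)"
  defines "vs \<equiv> sorted_list_of_set (verts G)"
  shows "dist_mat G i *\<^sub>v vec (length vs) (\<lambda>r. f (vs ! r)) =
    vec (length vs) (\<lambda>r. \<Sum>v\<in>sphere_at G i (vs ! r). f v)"
proof (rule eq_vecI)
  fix r assume "r < dim_vec (vec (length vs) (\<lambda>r. \<Sum>v\<in>sphere_at G i (vs ! r). f v))"
  then have r: "r < length vs" by simp
  have bij: "bij_betw ((!) vs) {0..<length vs} (verts G)"
    by (rule bij_betw_nth) (simp_all add: vs_def fin lessThan_atLeast0)
  have "(dist_mat G i *\<^sub>v vec (length vs) (\<lambda>r. f (vs ! r))) $ r =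
      (\<Sum>c = 0..<length vs. if gdist G (vs ! r) (vs ! c) = i then f (vs ! c) else 0)"
    using r by (auto simp: dist_mat_def Let_def vs_def[symmetric] scalar_prod_def intro!: sum.cong)
  also have "\<dots> = (\<Sum>v\<in>verts G. if gdist G (vs ! r) v = i then f v else 0)"
    by (rule sum.reindex_bij_betw[OF bij])
  also have "\<dots> = (\<Sum>v\<in>sphere_at G i (vs ! r). f v)"
    unfolding sphere_at_def using fin by (simp add: sum.inter_filter)
  finally show "(dist_mat G i *\<^sub>v vec (length vs) (\<lambda>r. f (vs ! r))) $ r =
      vec (length vs) (\<lambda>r. \<Sum>v\<in>sphere_at G i (vs ! r). f v) $ r"
    using r by simp
qed (simp add: dist_mat_def Let_def vs_def)

definition sphere_eigenfunction :: "('a, 'b) pre_digraph \<Rightarrow> nat \<Rightarrow> real \<Rightarrow> ('a \<Rightarrow> real) \<Rightarrow> bool" where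
  "sphere_eigenfunction G i a f \<longleftrightarrow> (\<forall>u\<in>verts G. (\<Sum>v\<in>sphere_at G i u. f v) = a * f u)"

text \<open>
  With \<open>A\<^sub>i = p(A\<^sub>1)\<close> the constant is \<open>p(a)\<close>. What matters is that one constant serves all
  eigenfunctions: two of them with different \<open>i\<close>-th eigenvalues refute DP.
\<close>

lemma DP_sphere_eigenfunction:
  fixes G :: "('a::linorder, 'b) pre_digraph" and a :: real
  assumes DP: "DP G" and fin: "finite (verts G)" and i: "i \<in> {1..diam G}"
  shows "\<exists>c. \<forall>f. sphere_eigenfunction G 1 a f \<longrightarrow> sphere_eigenfunction G i c f"
proof -
  from DP i obtain p where p: "dist_mat G i = poly_at_mat p (dist_mat G 1)"
    unfolding DP_def by blast
  define vs where "vs = sorted_list_of_set (verts G)"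
  have "(\<Sum>v\<in>sphere_at G i u. f v) = poly p a * f u"
    if "sphere_eigenfunction G 1 a f" and u: "u \<in> verts G" for f u
  proof -
    from that(1) have eigen: "(\<Sum>v\<in>sphere_at G 1 w. f v) = a * f w" if "w \<in> verts G" for w
      using that by (simp add: sphere_eigenfunction_def)
    let ?x = "vec (length vs) (\<lambda>r. f (vs ! r))"
    have set_vs: "set vs = verts G"
      by (simp add: vs_def fin)
    then have "vs ! r \<in> verts G" if "r < length vs" for r
      using that nth_mem by blast
    then have "vec (length vs) (\<lambda>r. \<Sum>v\<in>sphere_at G 1 (vs ! r). f v) = a \<cdot>\<^sub>v ?x"
      by (intro eq_vecI) (simp_all add: eigen del: One_nat_def)
    then have "dist_mat G 1 *\<^sub>v ?x = a \<cdot>\<^sub>v ?x"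
      using dist_mat_mult_vec[OF fin, of 1 f] unfolding vs_def by (rule trans[rotated])
    moreover have "dist_mat G 1 \<in> carrier_mat (length vs) (length vs)"
      by (simp add: dist_mat_def Let_def vs_def)
    ultimately have "dist_mat G i *\<^sub>v ?x = poly p a \<cdot>\<^sub>v ?x"
      unfolding p by (intro poly_at_mat_mult_vec) auto
    then have *: "vec (length vs) (\<lambda>r. \<Sum>v\<in>sphere_at G i (vs ! r). f v) = poly p a \<cdot>\<^sub>v ?x"
      unfolding vs_def dist_mat_mult_vec[OF fin] .
    from u obtain r where "r < length vs" "vs ! r = u"
      using set_vs by (metis in_set_conv_nth)
    with arg_cong[OF *, of "\<lambda>y. y $ r"] show ?thesis by simp
  qed
  then show ?thesis
    unfolding sphere_eigenfunction_def[of G i] by blast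
qed


section \<open>Absolute value modulo n\<close>

text \<open>
  The least absolute value in the residue class of \<open>x\<close>, which is the distance of \<open>0\<close> and \<open>x\<close> on a
  cycle of length \<open>n\<close>. The triangle inequality, the descent and the exact values all come from
  two properties: every representative bounds it from above, and some representative attains it.
\<close>

definition circ_norm :: "nat \<Rightarrow> int \<Rightarrow> int" where
  "circ_norm n x = min (x mod int n) (- x mod int n)"

lemma circ_norm_cong: "x mod int n = y mod int n \<Longrightarrow> circ_norm n x = circ_norm n y"
  unfolding circ_norm_def by (metis mod_minus_cong)

lemma circ_norm_minus [simp]: "circ_norm n (- x) = circ_norm n x"
  by (simp add: circ_norm_def min.commute)

lemma circ_norm_le_abs:
  assumes "n > 0" and "int n dvd x - z"
  shows "circ_norm n x \<le> \<bar>z\<bar>"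
proof -
  have "circ_norm n x = circ_norm n z"
    using assms(2) by (intro circ_norm_cong) (simp add: mod_eq_dvd_iff)
  also have "\<dots> \<le> \<bar>z\<bar>"
  proof (cases "z \<ge> 0")
    case True
    then have "z mod int n \<le> z" using assms(1) by (simp add: zmod_le_nonneg_dividend)
    then show ?thesis by (simp add: circ_norm_def)
  next
    case False
    then have "- z mod int n \<le> - z" using assms(1) by (simp add: zmod_le_nonneg_dividend)
    then show ?thesis by (simp add: circ_norm_def)
  qed
  finally show ?thesis .
qed

lemma circ_norm_attained:
  assumes "n > 0"
  obtains z where "int n dvd x - z" and "\<bar>z\<bar> = circ_norm n x"
proof -
  have "x mod int n \<ge> 0" "- x mod int n \<ge> 0" using assms by simp_all
  moreover have "int n dvd x - x mod int n" by simp
  moreover have "int n dvd x - - (- x mod int n)"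
    using dvd_minus_mod[of "int n" "- x"] dvd_minus_iff[of "int n" "- x - (- x mod int n)"]
    by (simp add: add.commute)
  ultimately show thesis
    using that[of "x mod int n"] that[of "- (- x mod int n)"]
    unfolding circ_norm_def by (cases "x mod int n \<le> - x mod int n") auto
qed

lemma circ_norm_triangle:
  assumes n: "n > 0"
  shows "circ_norm n (x + y) \<le> circ_norm n x + circ_norm n y"
proof -
  obtain z w where zw: "int n dvd x - z" "\<bar>z\<bar> = circ_norm n x"
      "int n dvd y - w" "\<bar>w\<bar> = circ_norm n y"
    by (metis circ_norm_attained[OF n])
  then have "int n dvd (x + y) - (z + w)"
    by (metis add_diff_add dvd_add)
  from circ_norm_le_abs[OF n this] zw show ?thesis by linarith
qed

text \<open>The step \<open>e\<close> moves a representative of minimal absolute value towards 0.\<close>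

lemma circ_norm_descent:
  assumes n: "n > 0" and x: "circ_norm n x > 0"
  obtains e where "\<bar>e\<bar> = 1" and "circ_norm n (x + e) < circ_norm n x"
proof -
  obtain z where z: "int n dvd x - z" "\<bar>z\<bar> = circ_norm n x"
    by (metis circ_norm_attained[OF n])
  have "int n dvd (x + - sgn z) - (z + - sgn z)" using z by simp
  then have "circ_norm n (x + - sgn z) \<le> \<bar>z + - sgn z\<bar>"
    by (rule circ_norm_le_abs[OF n])
  with z x show thesis
    by (intro that[of "- sgn z"]) (auto simp: sgn_if)
qed

lemma circ_norm_le_iff:
  assumes n: "n > 0"
  shows "circ_norm n x \<le> k \<longleftrightarrow> (\<exists>z. \<bar>z\<bar> \<le> k \<and> int n dvd x - z)"
  using circ_norm_attained[OF n, of x] circ_norm_le_abs[OF n, of x] by (metis order_trans order_refl)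

lemma circ_norm_nonneg: "n > 0 \<Longrightarrow> circ_norm n x \<ge> 0"
  by (simp add: circ_norm_def)

text \<open>
  Two representatives of which one has absolute value at most \<open>n / 2\<close> and the other a smaller one
  would differ by less than \<open>n\<close>.
\<close>

lemma circ_norm_eq_abs:
  assumes n: "n > 0" and z: "int n dvd x - z" "2 * \<bar>z\<bar> \<le> int n"
  shows "circ_norm n x = \<bar>z\<bar>"
proof (rule antisym[OF circ_norm_le_abs[OF n z(1)]], rule ccontr)
  assume "\<not> \<bar>z\<bar> \<le> circ_norm n x"
  moreover obtain w where w: "int n dvd x - w" "\<bar>w\<bar> = circ_norm n x"
    using circ_norm_attained[OF n] .
  ultimately have less: "\<bar>w\<bar> < \<bar>z\<bar>" by simp
  have "int n dvd (x - w) - (x - z)" using w(1) z(1) by (rule dvd_diff)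
  then have "int n dvd z - w" by simp
  moreover have "\<bar>z - w\<bar> < int n" using less z(2) by linarith
  ultimately have "z - w = 0" using dvd_imp_le_int[of "z - w" "int n"] by linarith
  with less show False by simp
qed


section \<open>The lexicographic product of a cycle with a single edge\<close>

text \<open>
  The twins over a vertex \<open>i < n\<close> of the cycle are \<open>i\<close> and \<open>i + n\<close>. Compared with a numbering by
  \<open>2 * i\<close> and \<open>2 * i + 1\<close>, this makes addition modulo \<open>2 * n\<close> act by automorphisms.
\<close>

definition doubled_cycle :: "nat \<Rightarrow> nat pair_pre_digraph" where
  "doubled_cycle n = \<lparr> pverts = {..<2 * n},
    parcs = {(u, v). u < 2 * n \<and> v < 2 * n \<and> u \<noteq> v \<and> circ_norm n (int u - int v) \<le> 1} \<rparr>"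

lemma pverts_doubled_cycle [simp]: "pverts (doubled_cycle n) = {..<2 * n}"
  by (simp add: doubled_cycle_def)

lemma parcs_doubled_cycle: "(u, v) \<in> parcs (doubled_cycle n) \<longleftrightarrow>
    u < 2 * n \<and> v < 2 * n \<and> u \<noteq> v \<and> circ_norm n (int u - int v) \<le> 1"
  by (simp add: doubled_cycle_def)

lemma circ_norm_diff_commute: "circ_norm n (x - y) = circ_norm n (y - x)"
  using circ_norm_minus[of n "x - y"] by simp

lemma pair_graph_doubled_cycle: "pair_graph (doubled_cycle n)"
proof
  show "finite (parcs (doubled_cycle n))"
    by (rule finite_subset[of _ "{..<2 * n} \<times> {..<2 * n}"]) (auto simp: parcs_doubled_cycle)
  show "Digraph.symmetric (with_proj (doubled_cycle n))"
    by (auto simp: symmetric_def sym_def parcs_doubled_cycle circ_norm_diff_commute)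
qed (auto simp: parcs_doubled_cycle)

text \<open>
  The distance is the one of the projections to the cycle, except that distinct twins have
  distance 1; the maximum with 1 accounts for them.
\<close>

lemma doubled_cycle_distance:
  assumes n: "n > 0" and u: "u < 2 * n" and v: "v < 2 * n"
  shows reachable_doubled_cycle: "u \<rightarrow>\<^sup>*\<^bsub>with_proj (doubled_cycle n)\<^esub> v"
    and gdist_doubled_cycle: "gdist (with_proj (doubled_cycle n)) u v =
      (if u = v then 0 else max 1 (nat (circ_norm n (int u - int v))))"
proof -
  interpret pair_graph "doubled_cycle n" by (rule pair_graph_doubled_cycle)
  let ?N = "\<lambda>v. circ_norm n (int u - int v)"
  let ?\<delta> = "\<lambda>v. if u = v then 0 else max 1 (nat (?N v))"
  note gdist = wf_digraph.gdist_eqI[OF wf_digraph_axioms, of u ?\<delta> v,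
      unfolded with_proj_simps pverts_doubled_cycle lessThan_iff]
  have lipschitz: "?\<delta> (snd e) \<le> Suc (?\<delta> (fst e))" if "e \<in> parcs (doubled_cycle n)" for e
  proof -
    obtain x y where e: "e = (x, y)" by (cases e)
    with that have xy: "circ_norm n (int x - int y) \<le> 1"
      by (simp add: parcs_doubled_cycle)
    moreover have "?N y \<le> ?N x + circ_norm n (int x - int y)"
      using circ_norm_triangle[OF n, of "int u - int x" "int x - int y"] by simp
    ultimately show ?thesis
      using circ_norm_nonneg[OF n, of "int u - int x"] by (auto simp: e)
  qed
  have descent: "\<exists>e\<in>parcs (doubled_cycle n). snd e = w \<and> ?\<delta> (fst e) < ?\<delta> w"
    if w: "w < 2 * n" "w \<noteq> u" for w
  proof (cases "?N w \<le> 1")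
    case True
    with w u show ?thesis
      by (intro bexI[of _ "(u, w)"]) (auto simp: parcs_doubled_cycle)
  next
    case False
    then have "?N w > 0" by simp
    then obtain e where e: "\<bar>e\<bar> = 1" "circ_norm n (int u - int w + e) < ?N w"
      using circ_norm_descent[OF n] by blast
    (* one step back along the cycle; any vertex over that place would do, and this one is below n *)
    define x where "x = nat ((int w - e) mod int n)"
    have x: "int x = (int w - e) mod int n" "x < 2 * n"
    proof -
      show "int x = (int w - e) mod int n"
        using n by (simp add: x_def)
      moreover have "(int w - e) mod int n < int n"
        using n by simp
      ultimately show "x < 2 * n" by linarith
    qed
    have Nx: "?N x = circ_norm n (int u - int w + e)"
      by (rule circ_norm_cong) (simp add: x mod_simps algebra_simps)
    have "circ_norm n (int x - int w) = circ_norm n (- e)"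
      by (rule circ_norm_cong) (simp add: x mod_simps)
    also have "\<dots> \<le> 1"
      using circ_norm_le_abs[OF n, of "- e" "- e"] e(1) by simp
    finally have "(x, w) \<in> parcs (doubled_cycle n)"
      using x w Nx e(2) by (auto simp: parcs_doubled_cycle)
    moreover have "?\<delta> x < ?\<delta> w"
      using Nx e(2) False w(2) by auto
    ultimately show ?thesis by (intro bexI[of _ "(x, w)"]) auto
  qed
  show "u \<rightarrow>\<^sup>*\<^bsub>with_proj (doubled_cycle n)\<^esub> v"
    by (rule gdist(1)[OF u _ lipschitz descent v]) simp_all
  show "gdist (with_proj (doubled_cycle n)) u v = ?\<delta> v"
    by (rule gdist(2)[OF u _ lipschitz descent v]) simp_all
qed

lemma connected_doubled_cycle:
  assumes "n > 0"
  shows "Digraph_Component.connected (with_proj (doubled_cycle n))"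
proof -
  interpret pair_graph "doubled_cycle n" by (rule pair_graph_doubled_cycle)
  show ?thesis
    unfolding Digraph_Component.connected_def
  proof (rule strongly_connectedI)
    show "verts (with_proj (mk_symmetric (with_proj (doubled_cycle n)))) \<noteq> {}"
      using assms by (auto simp: lessThan_empty_iff)
    fix u v
    assume "u \<in> verts (with_proj (mk_symmetric (with_proj (doubled_cycle n))))"
      "v \<in> verts (with_proj (mk_symmetric (with_proj (doubled_cycle n))))"
    then show "u \<rightarrow>\<^sup>*\<^bsub>with_proj (mk_symmetric (with_proj (doubled_cycle n)))\<^esub> v"
      using assms by (intro reachable_mk_symmetricI reachable_doubled_cycle) auto
  qed
qed

lemma generously_transitive_doubled_cycle:
  assumes n: "n > 0"
  shows "generously_transitive (with_proj (doubled_cycle n))"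
  unfolding generously_transitive_def
proof (intro ballI)
  fix u v assume "u \<in> verts (with_proj (doubled_cycle n))" "v \<in> verts (with_proj (doubled_cycle n))"
  then have uv: "u < 2 * n" "v < 2 * n" by auto
  (* the reflection that exchanges u and v *)
  define \<phi> where "\<phi> x = nat ((int u + int v - int x) mod (2 * int n))" for x
  have \<phi>: "int (\<phi> x) = (int u + int v - int x) mod (2 * int n)" for x
    using n by (simp add: \<phi>_def)
  have \<phi>_less: "\<phi> x < 2 * n" for x
  proof -
    have "(int u + int v - int x) mod (2 * int n) < 2 * int n" using n by simp
    with \<phi>[of x] show ?thesis by linarith
  qed
  have invol: "\<phi> (\<phi> x) = x" if "x < 2 * n" for x
  proof -
    have "int (\<phi> (\<phi> x)) = int x mod (2 * int n)"
      unfolding \<phi>[of "\<phi> x"] \<phi>[of x] by (simp add: mod_simps)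
    with that show ?thesis by simp
  qed
  have bij: "bij_betw \<phi> {..<2 * n} {..<2 * n}"
    by (rule bij_betw_byWitness[of _ \<phi>]) (auto simp: invol \<phi>_less)
  have norm: "circ_norm n (int (\<phi> x) - int (\<phi> y)) = circ_norm n (int x - int y)" for x y
  proof -
    have "int (\<phi> x) mod int n = (int u + int v - int x) mod int n" for x
      unfolding \<phi> by (simp add: mod_mod_cancel)
    then have "(int (\<phi> x) - int (\<phi> y)) mod int n =
        ((int u + int v - int x) - (int u + int v - int y)) mod int n"
      by (metis mod_diff_eq)
    then have "circ_norm n (int (\<phi> x) - int (\<phi> y)) = circ_norm n (int y - int x)"
      by (intro circ_norm_cong) simp
    then show ?thesis by (simp add: circ_norm_diff_commute)
  qed
  have "gdist (with_proj (doubled_cycle n)) (\<phi> x) (\<phi> y) = gdist (with_proj (doubled_cycle n)) x y"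
    if "x < 2 * n" "y < 2 * n" for x y
  proof -
    have "\<phi> x = \<phi> y \<longleftrightarrow> x = y" using that invol by metis
    then show ?thesis using that by (simp add: gdist_doubled_cycle n \<phi>_less norm)
  qed
  with bij have "gdist_isometry (with_proj (doubled_cycle n)) \<phi>"
    by (simp add: gdist_isometry_def)
  moreover have "\<phi> u = v" "\<phi> v = u" using uv by (simp_all add: \<phi>_def nat_mod_as_int)
  ultimately show "\<exists>\<phi>. gdist_isometry (with_proj (doubled_cycle n)) \<phi> \<and> \<phi> u = v \<and> \<phi> v = u"
    by blast
qed

lemma diam_doubled_cycle:
  assumes n: "n > 1"
  shows "n div 2 \<le> diam (with_proj (doubled_cycle n))"
proof -
  let ?G = "with_proj (doubled_cycle n)"
  have "circ_norm n (int 0 - int (n div 2)) = \<bar>- int (n div 2)\<bar>"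
    by (rule circ_norm_eq_abs) (use n in auto)
  moreover have "n div 2 > 0" using n by simp
  ultimately have "gdist ?G 0 (n div 2) = n div 2"
    using n by (subst gdist_doubled_cycle) auto
  then have "n div 2 \<in> {gdist ?G u v | u v. u \<in> verts ?G \<and> v \<in> verts ?G}"
    using n by (intro CollectI exI[of _ 0] exI[of _ "n div 2"]) simp
  moreover have "finite {gdist ?G u v | u v. u \<in> verts ?G \<and> v \<in> verts ?G}"
    by (rule finite_subset[of _ "(\<lambda>(u, v). gdist ?G u v) ` ({..<2 * n} \<times> {..<2 * n})"]) auto
  ultimately show ?thesis
    unfolding diam_def by (intro Max_ge)
qed


section \<open>Two eigenfunctions for the eigenvalue -1\<close>

text \<open>
  The vertices over a place of the cycle form a pair of twins, so a sum over the vertices that lie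
  over given places splits into one summand for each pair. Spheres of radius at least 2 and closed
  neighbourhoods have this form. The places are given relative to a base point \<open>a\<close>.
\<close>

lemma sum_residues:
  fixes F :: "nat \<Rightarrow> 'a::comm_monoid_add"
  assumes n: "n > 0" and Z: "finite Z"
    and incong: "\<And>z z'. z \<in> Z \<Longrightarrow> z' \<in> Z \<Longrightarrow> int n dvd z - z' \<Longrightarrow> z = z'"
  shows "(\<Sum>v | v < 2 * n \<and> (\<exists>z\<in>Z. int n dvd int v - a - z). F v) =
    (\<Sum>z\<in>Z. F (nat ((a + z) mod int n)) + F (nat ((a + z) mod int n) + n))"
proof -
  define fibre where "fibre z = {nat ((a + z) mod int n), nat ((a + z) mod int n) + n}" for z
  have fibre_iff: "v \<in> fibre z \<longleftrightarrow> v < 2 * n \<and> int n dvd int v - a - z" for v z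
  proof -
    define r where "r = nat ((a + z) mod int n)"
    have r: "int r = (a + z) mod int n" "r < n"
      using n by (simp_all add: r_def nat_less_iff)
    have "int n dvd int v - (a + z) \<longleftrightarrow> int (v mod n) = int r"
      by (simp add: r mod_eq_dvd_iff[symmetric] zmod_int)
    then have "int n dvd int v - a - z \<longleftrightarrow> v mod n = r"
      by (simp add: diff_diff_eq)
    moreover have "v < 2 * n \<and> v mod n = r \<longleftrightarrow> v = r \<or> v = r + n"
    proof (cases "v < n")
      case False
      then show ?thesis using r(2) by (auto simp: le_mod_geq)
    qed (use r(2) in auto)
    ultimately show ?thesis by (simp add: fibre_def r_def)
  qed
  have disj: "fibre z \<inter> fibre z' = {}" if "z \<in> Z" "z' \<in> Z" "z \<noteq> z'" for z z'
  proof (rule ccontr)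
    assume "fibre z \<inter> fibre z' \<noteq> {}"
    then obtain v where "int n dvd int v - a - z'" "int n dvd int v - a - z"
      using fibre_iff by blast
    then have "int n dvd (int v - a - z') - (int v - a - z)" by (rule dvd_diff)
    with incong that show False by simp
  qed
  have "{v. v < 2 * n \<and> (\<exists>z\<in>Z. int n dvd int v - a - z)} = (\<Union>z\<in>Z. fibre z)"
    using fibre_iff by blast
  moreover have "sum F (\<Union>z\<in>Z. fibre z) = (\<Sum>z\<in>Z. sum F (fibre z))"
    using Z disj by (intro sum.UNION_disjoint) (auto simp: fibre_def)
  moreover have "sum F (fibre z) = F (nat ((a + z) mod int n)) + F (nat ((a + z) mod int n) + n)" for z
    using n by (simp add: fibre_def)
  ultimately show ?thesis by simp
qed

text \<open>
  The sphere of radius 1 contains the twin of \<open>u\<close> but not \<open>u\<close>: it is the union of three pairs of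
  twins without \<open>u\<close>, and they are distinct for \<open>n \<ge> 3\<close>.
\<close>

lemma sum_sphere_1_doubled_cycle:
  fixes F :: "nat \<Rightarrow> real"
  assumes n: "n \<ge> 3" and u: "u < 2 * n"
  shows "(\<Sum>v\<in>sphere_at (with_proj (doubled_cycle n)) 1 u. F v) =
    (\<Sum>z\<in>{- 1, 0, 1}. F (nat ((int u + z) mod int n)) + F (nat ((int u + z) mod int n) + n)) - F u"
proof -
  let ?Z = "{- 1, 0, 1 :: int}"
  let ?B = "{v. v < 2 * n \<and> (\<exists>z\<in>?Z. int n dvd int v - int u - z)}"
  have n0: "n > 0" using n by simp
  have near: "circ_norm n (int u - int v) \<le> 1 \<longleftrightarrow> (\<exists>z\<in>?Z. int n dvd int v - int u - z)" for v
  proof -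
    have "\<bar>z\<bar> \<le> 1 \<longleftrightarrow> z \<in> ?Z" for z :: int by auto
    then show ?thesis
      unfolding circ_norm_diff_commute[of n "int u" "int v"] circ_norm_le_iff[OF n0] Bex_def
      by (rule ex_cong1[OF arg_cong2[of _ _ _ _ "(\<and>)"]]) simp
  qed
  have "gdist (with_proj (doubled_cycle n)) u v = 1 \<longleftrightarrow>
      v \<noteq> u \<and> circ_norm n (int u - int v) \<le> 1" if "v < 2 * n" for v
    using that u by (auto simp: gdist_doubled_cycle n0 max_def)
  then have "sphere_at (with_proj (doubled_cycle n)) 1 u = ?B - {u}"
    unfolding sphere_at_def near[symmetric] by auto
  moreover have "u \<in> ?B" "finite ?B" using u by auto
  ultimately have sphere: "(\<Sum>v\<in>sphere_at (with_proj (doubled_cycle n)) 1 u. F v) = sum F ?B - F u"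
    by (simp add: sum_diff1)
  have incong: "z = z'" if "z \<in> ?Z" "z' \<in> ?Z" "int n dvd z - z'" for z z'
  proof -
    have "\<bar>z - z'\<bar> < int n" using that(1,2) n by auto
    with that(3) show ?thesis using dvd_imp_le_int[of "z - z'" "int n"] by force
  qed
  have "sum F ?B = (\<Sum>z\<in>?Z. F (nat ((int u + z) mod int n)) + F (nat ((int u + z) mod int n) + n))"
    by (rule sum_residues[OF n0], simp, erule (2) incong)
  with sphere show ?thesis by simp
qed

text \<open>The bound on \<open>n\<close> makes the places at \<open>- 2\<close> and \<open>2\<close> distinct and keeps them outside the closed neighbourhood.\<close>

lemma sum_sphere_2_doubled_cycle:
  fixes F :: "nat \<Rightarrow> real"
  assumes n: "n \<ge> 5" and u: "u < 2 * n"
  shows "(\<Sum>v\<in>sphere_at (with_proj (doubled_cycle n)) 2 u. F v) =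
    (\<Sum>z\<in>{- 2, 2}. F (nat ((int u + z) mod int n)) + F (nat ((int u + z) mod int n) + n))"
proof -
  let ?Z = "{- 2, 2 :: int}"
  let ?S = "{v. v < 2 * n \<and> (\<exists>z\<in>?Z. int n dvd int v - int u - z)}"
  have n0: "n > 0" using n by simp
  have two: "circ_norm n (int u - int v) = 2 \<longleftrightarrow> (\<exists>z\<in>?Z. int n dvd int v - int u - z)" for v
    unfolding circ_norm_diff_commute[of n "int u" "int v"]
  proof
    assume "circ_norm n (int v - int u) = 2"
    moreover obtain z where z: "int n dvd int v - int u - z" "\<bar>z\<bar> = circ_norm n (int v - int u)"
      using circ_norm_attained[OF n0] .
    ultimately have "z \<in> ?Z" by auto
    with z(1) show "\<exists>z\<in>?Z. int n dvd int v - int u - z" by blast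
  next
    assume "\<exists>z\<in>?Z. int n dvd int v - int u - z"
    then obtain z where z: "z \<in> ?Z" "int n dvd int v - int u - z" by blast
    then have "\<bar>z\<bar> = 2" by auto
    with circ_norm_eq_abs[OF n0 z(2)] n show "circ_norm n (int v - int u) = 2" by simp
  qed
  have "circ_norm n 0 = 0"
    by (simp add: circ_norm_def)
  then have "gdist (with_proj (doubled_cycle n)) u v = 2 \<longleftrightarrow> circ_norm n (int u - int v) = 2"
    if "v < 2 * n" for v
    using that u by (auto simp: gdist_doubled_cycle n0 max_def)
  then have sphere: "sphere_at (with_proj (doubled_cycle n)) 2 u = ?S"
    unfolding sphere_at_def two[symmetric] by auto
  have incong: "z = z'" if "z \<in> ?Z" "z' \<in> ?Z" "int n dvd z - z'" for z z'
  proof -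
    have "\<bar>z - z'\<bar> < int n" using that(1,2) n by auto
    with that(3) show ?thesis using dvd_imp_le_int[of "z - z'" "int n"] by force
  qed
  have "sum F ?S = (\<Sum>z\<in>?Z. F (nat ((int u + z) mod int n)) + F (nat ((int u + z) mod int n) + n))"
    by (rule sum_residues[OF n0], simp, erule (2) incong)
  with sphere show ?thesis by simp
qed

lemma not_DP_doubled_cycle:
  assumes n: "n \<ge> 6" and dvd: "3 dvd n"
  shows "\<not> DP (with_proj (doubled_cycle n))"
proof
  let ?G = "with_proj (doubled_cycle n)"
  assume "DP ?G"
  moreover have "finite (verts ?G)" by simp
  moreover have "2 \<in> {1..diam ?G}"
    using n diam_doubled_cycle[of n] by auto
  ultimately obtain c where c: "sphere_eigenfunction ?G 2 c f"
    if "sphere_eigenfunction ?G 1 (- 1) f" for f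
    using DP_sphere_eigenfunction by blast
  have at_0: "(\<Sum>v\<in>sphere_at ?G 2 0. f v) = c * f 0" if "sphere_eigenfunction ?G 1 (- 1) f" for f
    using c[OF that] n by (simp add: sphere_eigenfunction_def)
  (* the difference of the indicators of the twins 0 and n *)
  define g :: "nat \<Rightarrow> real" where "g v = (if v = 0 then 1 else if v = n then - 1 else 0)" for v
  have g: "g (nat (z mod int n)) + g (nat (z mod int n) + n) = 0" for z
  proof -
    have "z mod int n < int n" using n by simp
    then have "nat (z mod int n) < n" using n by (simp add: nat_less_iff)
    then show ?thesis using n by (auto simp: g_def)
  qed
  have "sphere_eigenfunction ?G 1 (- 1) g"
    unfolding sphere_eigenfunction_def
    using n by (simp add: sum_sphere_1_doubled_cycle g del: One_nat_def)
  then have "(\<Sum>v\<in>sphere_at ?G 2 0. g v) = c * g 0" by (rule at_0)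
  moreover have "(\<Sum>v\<in>sphere_at ?G 2 0. g v) = 0"
    using n by (simp add: sum_sphere_2_doubled_cycle g)
  ultimately have "c = 0" by (simp add: g_def)
  (* sums to 0 over any three consecutive places, and is well defined on places as 3 divides n *)
  define h :: "nat \<Rightarrow> real" where "h v = (if 3 dvd v then 2 else - 1)" for v
  have h: "h (nat (z mod int n)) + h (nat (z mod int n) + n) = (if 3 dvd z then 4 else - 2)" for z
  proof -
    have "3 dvd nat (z mod int n) \<longleftrightarrow> int 3 dvd z mod int n"
      using n by (simp add: int_dvd_int_iff[symmetric] del: of_nat_numeral)
    also have "\<dots> \<longleftrightarrow> 3 dvd z"
      using dvd by (simp add: dvd_mod_iff int_dvd_int_iff[of 3 n, simplified])
    finally show ?thesis using dvd by (simp add: h_def dvd_add_left_iff)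
  qed
  have "sphere_eigenfunction ?G 1 (- 1) h"
    unfolding sphere_eigenfunction_def
  proof
    fix u assume "u \<in> verts ?G"
    then have "(\<Sum>v\<in>sphere_at ?G 1 u. h v) =
        (\<Sum>z\<in>{- 1, 0, 1}. if 3 dvd int u + z then 4 else - 2) - h u"
      using n by (simp add: sum_sphere_1_doubled_cycle h del: One_nat_def)
    moreover have "(\<Sum>z\<in>{- 1, 0, 1}. if 3 dvd int u + z then 4 else - 2 :: real) = 0"
    proof -
      have "3 dvd int u - 1 \<and> \<not> 3 dvd int u \<and> \<not> 3 dvd int u + 1 \<or>
          \<not> 3 dvd int u - 1 \<and> 3 dvd int u \<and> \<not> 3 dvd int u + 1 \<or>
          \<not> 3 dvd int u - 1 \<and> \<not> 3 dvd int u \<and> 3 dvd int u + 1"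
        by presburger
      then show ?thesis by (elim disjE) simp_all
    qed
    ultimately show "(\<Sum>v\<in>sphere_at ?G 1 u. h v) = - 1 * h u" by simp
  qed
  then have "(\<Sum>v\<in>sphere_at ?G 2 0. h v) = c * h 0" by (rule at_0)
  moreover have "(\<Sum>v\<in>sphere_at ?G 2 0. h v) = - 4"
    using n by (simp add: sum_sphere_2_doubled_cycle h)
  ultimately show False using \<open>c = 0\<close> by simp
qed

theorem corollary3p14:
  fixes n d :: nat
  shows "\<exists>G :: nat pair_pre_digraph.
    pair_graph G \<and> Digraph_Component.connected (with_proj G) \<and>
    card (pverts G) \<ge> n \<and> diam (with_proj G) \<ge> d \<and>
    DMR (with_proj G) \<and> CDDR (with_proj G) \<and> \<not> DP (with_proj G)"
proof -
  define m where "m = 3 * (n + d + 2)"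
  have m: "m \<ge> 6" "3 dvd m" "n \<le> 2 * m" "d \<le> m div 2"
    by (auto simp: m_def)
  have "generously_transitive (with_proj (doubled_cycle m))"
    using m by (intro generously_transitive_doubled_cycle) simp
  moreover have "d \<le> diam (with_proj (doubled_cycle m))"
    using diam_doubled_cycle[of m] m by linarith
  ultimately show ?thesis
    using m
    by (intro exI[of _ "doubled_cycle m"] conjI pair_graph_doubled_cycle connected_doubled_cycle
        generously_transitive_imp_DMR generously_transitive_imp_CDDR not_DP_doubled_cycle) auto
qed

end
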